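(* Let $n\ge 3$ and let $g(n,\mathbb{C})$ be the $2^n$-dimensional complex Clifford algebra generated by $e_1,\dots,e_n$ with $e_pe_q=-e_qe_p$ for $p\neq q$ and $e_p^2=-1$. Put $i=e_1e_2$, $j=e_1e_3$, $k=e_2e_3$, $z=e_1e_2e_3$, and for each $w\in\mathbb{C}$ let $\sqrt{w}$ denote a fixed choice of complex square root of $w$. Then, for every $a\in\mathbb{C}$, each of the following $\mathbb{C}$-linear spans is a $7$-dimensional subalgebra of $g(n,\mathbb{C})$: $$h_1=\mathrm{Span}\{1,\ e_1+k,\ e_2+ak,\ e_3+\sqrt{-1-a^2}\,k,\ i-\sqrt{-1-a^2}\,k,\ j+ak,\ z\},$$ $$h_2=\mathrm{Span}\{1,\ e_1+k,\ e_2+ak,\ e_3-\sqrt{-1-a^2}\,k,\ i+\sqrt{-1-a^2}\,k,\ j+ak,\ z\},$$ $$h_3=\mathrm{Span}\{1,\ e_1-k,\ e_2+ak,\ e_3+\sqrt{-1-a^2}\,k,\ i+\sqrt{-1-a^2}\,k,\ j-ak,\ z\},$$ $$h_4=\mathrm{Span}\{1,\ e_1-k,\ e_2+ak,\ e_3-\sqrt{-1-a^2}\,k,\ i-\sqrt{-1-a^2}\,k,\ j-ak,\ z\},$$ $$h_5=\mathrm{Span}\{1,\ e_1,\ e_2+j,\ e_3+\sqrt{-1}\,j,\ i+\sqrt{-1}\,j,\ k,\ z\},$$ $$h_6=\mathrm{Span}\{1,\ e_1,\ e_2+j,\ e_3-\sqrt{-1}\,j,\ i-\sqrt{-1}\,j,\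 k,\ z\},$$ $$h_7=\mathrm{Span}\{1,\ e_1,\ e_2-j,\ e_3+\sqrt{-1}\,j,\ i-\sqrt{-1}\,j,\ k,\ z\},$$ $$h_8=\mathrm{Span}\{1,\ e_1,\ e_2-j,\ e_3-\sqrt{-1}\,j,\ i+\sqrt{-1}\,j,\ k,\ z\}.$$
   Context: $g(n,\mathbb{C})$ is the associative unital $\mathbb{C}$-algebra generated by $e_1,\dots,e_n$ subject to $e_pe_q=-e_qe_p$ for $p\ne q$ and $e_p^2=-1$; it has $\mathbb{C}$-basis the products $e_{p_1}\cdots e_{p_m}$, $p_1<\dots<p_m$ (the empty product being the identity $1$). The algebra $g(3,\mathbb{C})$ is regarded as the subalgebra of $g(n,\mathbb{C})$ generated by $e_1,e_2,e_3$. The symbols $i,j,k,z$ denote elements of the algebra ($i$ is not the imaginary unit; the imaginary unit is written $\sqrt{-1}$). A subalgebra is a $\mathbb{C}$-linear subspace $h$ such that $xy\in h$ for all $x,y\in h$. *)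

theory Defs
  imports
    Complex_Main
    "HOL-Library.Poly_Mapping"
    "HOL-Algebra.Embedded_Algebras"
    "HOL-Algebra.QuotRing"
begin

section \<open>The free algebra on the letters 1, ..., n\<close>

text \<open>
  Words form a (non-commutative) monoid under concatenation. It is written additively so that the
  library's convolution product on finitely supported functions from words to complex numbers is
  the product of the monoid algebra, i.e. of non-commutative polynomials.
\<close>

datatype word = Word (letters: "nat list")

instantiation word :: monoid_add
begin

definition zero_word :: word where
  "0 = Word []"

definition plus_word :: "word \<Rightarrow> word \<Rightarrow> word" where
  "u + v = Word (letters u @ letters v)"

instance
  by standard (simp_all add: zero_word_def plus_word_def)

end

type_synonym ncpoly = "word \<Rightarrow>\<^sub>0 complex"

definition free_algebra :: "nat \<Rightarrow> ncpoly ring" where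
  "free_algebra n =
     \<lparr>carrier = {f. \<forall>w \<in> Poly_Mapping.keys f. set (letters w) \<subseteq> {1..n}},
      mult = (*), one = 1, zero = 0, add = (+)\<rparr>"

definition letter :: "nat \<Rightarrow> ncpoly" where
  "letter p = Poly_Mapping.single (Word [p]) 1"

lemma ring_free_algebra: "ring (free_algebra n)"
proof -
  define C where "C = carrier (free_algebra n)"
  have mem: "f \<in> C \<longleftrightarrow> (\<forall>w \<in> Poly_Mapping.keys f. set (letters w) \<subseteq> {1..n})" for f
    by (simp add: C_def free_algebra_def)
  have zero: "0 \<in> C" and one: "1 \<in> C"
    by (simp_all add: mem zero_word_def)
  have neg: "- f \<in> C" if "f \<in> C" for f
    using that by (simp add: mem)
  have plus: "f + g \<in> C" if "f \<in> C" "g \<in> C" for f g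
    using that Poly_Mapping.keys_add[of f g] unfolding mem by blast
  have times: "f * g \<in> C" if f: "f \<in> C" and g: "g \<in> C" for f g
    unfolding mem
  proof
    fix w assume "w \<in> Poly_Mapping.keys (f * g)"
    then obtain u v where "w = u + v" "u \<in> Poly_Mapping.keys f" "v \<in> Poly_Mapping.keys g"
      using keys_mult[of f g] by blast
    with f g show "set (letters w) \<subseteq> {1..n}"
      unfolding mem by (simp add: plus_word_def)
  qed
  have A: "free_algebra n = \<lparr>carrier = C, mult = (*), one = 1, zero = 0, add = (+)\<rparr>"
    by (simp add: C_def free_algebra_def)
  have inverse: "\<exists>g \<in> C. f + g = 0" if "f \<in> C" for f
    using neg[OF that] by (intro bexI[of _ "- f"]) simp_all
  show ?thesis
    unfolding A
  proof (rule ringI)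
    show "abelian_group \<lparr>carrier = C, mult = (*), one = 1, zero = 0, add = (+)\<rparr>"
      by (rule abelian_groupI) (simp_all add: zero plus inverse add.assoc add.commute)
    show "monoid \<lparr>carrier = C, mult = (*), one = 1, zero = 0, add = (+)\<rparr>"
      by (rule monoidI) (simp_all add: one times mult.assoc)
  qed (simp_all add: distrib_left distrib_right)
qed


section \<open>The complex Clifford algebra\<close>

definition clifford_relators :: "nat \<Rightarrow> ncpoly set" where
  "clifford_relators n =
     {letter p * letter q + letter q * letter p |p q. p \<in> {1..n} \<and> q \<in> {1..n} \<and> p \<noteq> q}
     \<union> {letter p * letter p + 1 |p. p \<in> {1..n}}"

definition clifford_ideal :: "nat \<Rightarrow> ncpoly set" where
  "clifford_ideal n = Idl\<^bsub>free_algebra n\<^esub> (clifford_relators n)"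

definition clifford :: "nat \<Rightarrow> ncpoly set ring" where
  "clifford n = free_algebra n Quot clifford_ideal n"

definition clifford_gen :: "nat \<Rightarrow> nat \<Rightarrow> ncpoly set" where
  "clifford_gen n p = clifford_ideal n +>\<^bsub>free_algebra n\<^esub> letter p"

text \<open>
  The structure map of the complex algebra: scalar multiplication by \<open>c\<close> is left multiplication by
  \<open>clifford_scalar n c\<close>, and the linear span and the dimension over the complex numbers are those
  of \<^theory>\<open>HOL-Algebra.Embedded_Algebras\<close> over the subfield \<open>clifford_scalars n\<close>.
\<close>

definition clifford_scalar :: "nat \<Rightarrow> complex \<Rightarrow> ncpoly set" where
  "clifford_scalar n c = clifford_ideal n +>\<^bsub>free_algebra n\<^esub> Poly_Mapping.single 0 c"

definition clifford_scalars :: "nat \<Rightarrow> ncpoly set set" where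
  "clifford_scalars n = range (clifford_scalar n)"

text \<open>
  The library predicate \<open>subalgebra K V R\<close> only says that \<open>V\<close> is a \<open>K\<close>-linear subspace of \<open>R\<close>, so
  closure under multiplication is added.
\<close>

definition clifford_subalgebra :: "nat \<Rightarrow> ncpoly set set \<Rightarrow> bool" where
  "clifford_subalgebra n h \<longleftrightarrow>
     subalgebra (clifford_scalars n) h (clifford n) \<and>
     (\<forall>x \<in> h. \<forall>y \<in> h. x \<otimes>\<^bsub>clifford n\<^esub> y \<in> h)"

definition clifford_span :: "nat \<Rightarrow> ncpoly set list \<Rightarrow> ncpoly set set" where
  "clifford_span n xs = ring.Span (clifford n) (clifford_scalars n) xs"

definition clifford_dimension :: "nat \<Rightarrow> nat \<Rightarrow> ncpoly set set \<Rightarrow> bool" where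
  "clifford_dimension n d h \<longleftrightarrow> ring.dimension (clifford n) d (clifford_scalars n) h"

lemma letter_in_carrier: "p \<in> {1..n} \<Longrightarrow> letter p \<in> carrier (free_algebra n)"
  by (auto simp: letter_def free_algebra_def)

lemma clifford_relators_in_carrier: "clifford_relators n \<subseteq> carrier (free_algebra n)"
proof -
  interpret ring "free_algebra n" by (rule ring_free_algebra)
  have plus: "f + g \<in> carrier (free_algebra n)" and times: "f * g \<in> carrier (free_algebra n)"
    and one: "1 \<in> carrier (free_algebra n)"
    if "f \<in> carrier (free_algebra n)" "g \<in> carrier (free_algebra n)" for f g
    using add.m_closed[OF that] m_closed[OF that] one_closed by (simp_all add: free_algebra_def)
  show ?thesis
    using letter_in_carrier unfolding clifford_relators_def
    by (auto intro!: plus times one)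
qed

lemma ideal_clifford_ideal: "ideal (clifford_ideal n) (free_algebra n)"
  unfolding clifford_ideal_def
  by (rule ring.genideal_ideal[OF ring_free_algebra clifford_relators_in_carrier])

lemma ring_clifford: "ring (clifford n)"
  unfolding clifford_def by (rule ideal.quotient_is_ring[OF ideal_clifford_ideal])

end

theory Submission
  imports Defs
begin

text \<open>
  Each span is the graph of a linear form: it consists of the elements of \<open>g(3, \<complex>)\<close> whose coordinate
  at one distinguished basis vector (\<open>k\<close> for \<open>h\<^sub>1, \<dots>, h\<^sub>4\<close>, and \<open>j\<close> for \<open>h\<^sub>5, \<dots>, h\<^sub>8\<close>) is a fixed linear
  combination of the other seven coordinates. The products of the basis vectors of \<open>g(3, \<complex>)\<close> turn
  closure under multiplication into a polynomial identity in the coordinates. The dimension requires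
  that the eight basis vectors are linearly independent in \<open>g(n, \<complex>)\<close>; for this, rewriting words to
  signed increasing words defines coordinate functionals on the free algebra, and these vanish on
  the ideal of relations because the two defining relations preserve signed normal forms.
\<close>

section \<open>Normal forms of words\<close>

text \<open>
  If \<open>w\<close> is strictly increasing, then \<open>e\<^sub>p e\<^sub>w\<close> is \<open>toggle_sign p w\<close> times \<open>e\<^sub>v\<close> with
  \<open>v = toggle p w\<close>: the letter \<open>p\<close> moves to its place and is cancelled by another \<open>p\<close>. Hence every
  word \<open>w\<close> equals \<open>nsign w\<close> times the increasing word \<open>nform w\<close> in the Clifford algebra.
\<close>

fun toggle :: "nat \<Rightarrow> nat list \<Rightarrow> nat list" where
  "toggle p [] = [p]"
| "toggle p (q # w) = (if p < q then p # q # w else if p = q then w else q # toggle p w)"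

fun toggle_sign :: "nat \<Rightarrow> nat list \<Rightarrow> complex" where
  "toggle_sign p [] = 1"
| "toggle_sign p (q # w) = (if p < q then 1 else if p = q then - 1 else - toggle_sign p w)"

fun nform :: "nat list \<Rightarrow> nat list" where
  "nform [] = []"
| "nform (p # w) = toggle p (nform w)"

fun nsign :: "nat list \<Rightarrow> complex" where
  "nsign [] = 1"
| "nsign (p # w) = toggle_sign p (nform w) * nsign w"

section \<open>Letters and order of normal forms\<close>

lemma set_toggle: "set (toggle p w) \<subseteq> insert p (set w)"
  by (induction w) auto

lemma set_nform: "set (nform w) \<subseteq> set w"
proof (induction w)
  case (Cons p w)
  then show ?case using set_toggle[of p "nform w"] by auto
qed simp

lemma sorted_wrt_toggle: "sorted_wrt (<) w \<Longrightarrow> sorted_wrt (<) (toggle p w)"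
proof (induction w)
  case (Cons q w)
  then show ?case using set_toggle[of p w] by (auto split: if_splits)
qed simp

lemma sorted_wrt_nform: "sorted_wrt (<) (nform w)"
  by (induction w) (simp_all add: sorted_wrt_toggle)

lemma toggle_eq_Cons: "\<forall>q\<in>set w. p < q \<Longrightarrow> toggle p w = p # w"
  by (cases w) auto

lemma toggle_sign_eq_1: "\<forall>q\<in>set w. p < q \<Longrightarrow> toggle_sign p w = 1"
  by (cases w) auto

lemma toggle_toggle: "sorted_wrt (<) w \<Longrightarrow> toggle p (toggle p w) = w"
  by (induction w) (auto simp: toggle_eq_Cons)

text \<open>This is \<open>e_p^2 = -1\<close> for signed toggling as left multiplication on
  increasing words. The letters below \<open>p\<close> give the same sign both times, and exactly
  one of the two toggles cancels a \<open>p\<close>, which contributes -1.\<close>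

lemma toggle_sign_toggle:
  "sorted_wrt (<) w \<Longrightarrow> toggle_sign p (toggle p w) * toggle_sign p w = - 1"
  by (induction w) (auto simp: toggle_sign_eq_1)

lemma toggle_commute:
  "sorted_wrt (<) w \<Longrightarrow> toggle p (toggle q w) = toggle q (toggle p w)"
proof (induction w)
  case (Cons r w)
  \<comment> \<open>The tail of an increasing word exceeds its head \<open>r\<close>, so a letter
    below \<open>r\<close> is simply prepended to the tail.\<close>
  have "toggle x w = x # w" if "x < r" for x
    using Cons.prems that by (auto intro!: toggle_eq_Cons)
  with Cons show ?case
    by (cases p q rule: linorder_cases) (auto simp: toggle_eq_Cons)
qed auto

text \<open>For \<open>p < q\<close>, toggling \<open>p\<close> changes the number of letters below
  \<open>q\<close> by one and so flips the sign of toggling \<open>q\<close>, while toggling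
  \<open>q\<close> leaves the letters up to \<open>p\<close> alone. Hence exactly one of the two
  signs changes.\<close>

lemma toggle_sign_anticommute:
  "sorted_wrt (<) w \<Longrightarrow> p \<noteq> q \<Longrightarrow>
     toggle_sign p (toggle q w) * toggle_sign q w = - (toggle_sign q (toggle p w) * toggle_sign p w)"
proof (induction w)
  case (Cons r w)
  have "toggle x w = x # w" "toggle_sign x w = 1" if "x < r" for x
    using Cons.prems that by (auto intro!: toggle_eq_Cons toggle_sign_eq_1)
  with Cons show ?case
    by (cases p q rule: linorder_cases) (auto simp: toggle_eq_Cons toggle_sign_eq_1)
qed auto

text \<open>Words are normalized from the right end, so a prefix sees only the normal form of what
  follows. This reduces a relation applied inside a word to one applied at its front.\<close>

lemma nform_prefix_cong:
  "nform v = nform w \<Longrightarrow> nform (u @ v) = nform (u @ w)"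
  by (induction u) simp_all

lemma nsign_prefix_cong:
  "nform v = nform w \<Longrightarrow> nsign v = c * nsign w \<Longrightarrow> nsign (u @ v) = c * nsign (u @ w)"
  by (induction u) (simp_all add: nform_prefix_cong[of v w])

lemma nform_swap: "nform (u @ p # q # v) = nform (u @ q # p # v)"
  by (rule nform_prefix_cong) (simp add: toggle_commute sorted_wrt_nform)

lemma nsign_swap: "p \<noteq> q \<Longrightarrow> nsign (u @ p # q # v) = - nsign (u @ q # p # v)"
  using nsign_prefix_cong[of "p # q # v" "q # p # v" "- 1" u]
    toggle_sign_anticommute[OF sorted_wrt_nform, of p q v]
  by (simp add: toggle_commute sorted_wrt_nform mult.assoc[symmetric])

lemma nform_square: "nform (u @ p # p # v) = nform (u @ v)"
  by (rule nform_prefix_cong) (simp add: toggle_toggle sorted_wrt_nform)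

lemma nsign_square: "nsign (u @ p # p # v) = - nsign (u @ v)"
  using nsign_prefix_cong[of "p # p # v" v "- 1" u]
    toggle_sign_toggle[OF sorted_wrt_nform, of p v]
  by (simp add: toggle_toggle sorted_wrt_nform mult.assoc[symmetric])

section \<open>Coordinates in the basis of increasing words\<close>

definition coord :: "nat list \<Rightarrow> ncpoly \<Rightarrow> complex" where
  "coord v f = (\<Sum>w\<in>Poly_Mapping.keys f.
     if nform (letters w) = v then nsign (letters w) * Poly_Mapping.lookup f w else 0)"

text \<open>Supports may shrink under cancellation; summing over a common superset makes additivity
  visible.\<close>

lemma coord_superset:
  assumes "finite A" "Poly_Mapping.keys f \<subseteq> A"
  shows "coord v f = (\<Sum>w\<in>A.
     if nform (letters w) = v then nsign (letters w) * Poly_Mapping.lookup f w else 0)"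
  unfolding coord_def using assms
  by (intro sum.mono_neutral_left) (auto simp: in_keys_iff)

lemma coord_add: "coord v (f + g) = coord v f + coord v g"
proof -
  let ?A = "Poly_Mapping.keys f \<union> Poly_Mapping.keys g"
  have "finite ?A" by simp
  then show ?thesis
    using Poly_Mapping.keys_add[of f g]
    by (simp add: coord_superset[of ?A] lookup_add sum.distrib[symmetric] distrib_left
        cong: if_cong) (auto intro!: sum.cong)
qed

lemma coord_zero [simp]: "coord v 0 = 0"
  by (simp add: coord_def)

lemma coord_uminus: "coord v (- f) = - coord v f"
  using coord_add[of v f "- f"] by (simp add: eq_neg_iff_add_eq_0 add.commute)

lemma coord_diff: "coord v (f - g) = coord v f - coord v g"
  using coord_add[of v f "- g"] by (simp add: coord_uminus)

lemma coord_sum: "coord v (sum f A) = (\<Sum>x\<in>A. coord v (f x))"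
  by (induction A rule: infinite_finite_induct) (simp_all add: coord_add)

lemma coord_single:
  "coord v (Poly_Mapping.single w c) =
     (if nform (letters w) = v then nsign (letters w) * c else 0)"
  by (simp add: coord_superset[of "{w}"])

text \<open>Updating at a fresh key amounts to adding a monomial, so additive properties need
  checking on monomials only.\<close>

lemma poly_mapping_add_induct [case_names zero single add]:
  assumes "P 0" "\<And>k c. P (Poly_Mapping.single k c)" "\<And>f g. P f \<Longrightarrow> P g \<Longrightarrow> P (f + g)"
  shows "P f"
proof (induction f rule: update_induct)
  case const
  then show ?case by (rule assms(1))
next
  case (update f a b)
  have "Poly_Mapping.update a b f = f + Poly_Mapping.single a b"
    using update(1)
    by (intro poly_mapping_eqI)
      (auto simp: lookup_update lookup_add lookup_single in_keys_iff when_def)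
  then show ?case using assms(2,3) update by simp
qed

text \<open>By additivity in both outer factors, it is enough to let them be monomials.\<close>

lemma coord_mult_eq_0:
  assumes "\<And>u v \<alpha> \<beta>. coord x (Poly_Mapping.single u \<alpha> * f * Poly_Mapping.single v \<beta>) = 0"
  shows "coord x (g * f * h) = 0"
proof (induction g rule: poly_mapping_add_induct)
  case (single u \<alpha>)
  show ?case
    by (induction h rule: poly_mapping_add_induct) (simp_all add: assms distrib_left coord_add)
qed (simp_all add: distrib_right coord_add)

section \<open>An ideal on which all coordinates vanish\<close>

lemma free_algebra_ops:
  "f \<oplus>\<^bsub>free_algebra n\<^esub> g = f + g" "f \<otimes>\<^bsub>free_algebra n\<^esub> g = f * g"
  "\<zero>\<^bsub>free_algebra n\<^esub> = 0" "\<one>\<^bsub>free_algebra n\<^esub> = 1"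
  by (simp_all add: free_algebra_def)

lemma free_algebra_a_inv:
  assumes "f \<in> carrier (free_algebra n)"
  shows "\<ominus>\<^bsub>free_algebra n\<^esub> f = - f"
  using ring.ring_simprules(9)[OF ring_free_algebra assms]
  by (simp add: free_algebra_ops eq_neg_iff_add_eq_0)

text \<open>
  The factors \<open>g\<close> and \<open>h\<close> make the set a two-sided ideal without any further argument.
\<close>

definition coord_kernel :: "nat \<Rightarrow> ncpoly set" where
  "coord_kernel n = {f \<in> carrier (free_algebra n). \<forall>g h x. coord x (g * f * h) = 0}"

lemma ideal_coord_kernel: "ideal (coord_kernel n) (free_algebra n)"
proof -
  interpret ring "free_algebra n" by (rule ring_free_algebra)
  show ?thesis
  proof (rule idealI)
    show "subgroup (coord_kernel n) (add_monoid (free_algebra n))"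
    proof (rule add.subgroupI)
      show "coord_kernel n \<noteq> {}"
        using zero_closed by (auto simp: coord_kernel_def free_algebra_ops intro!: exI[of _ 0])
    next
      fix f assume f: "f \<in> coord_kernel n"
      then have "\<ominus>\<^bsub>free_algebra n\<^esub> f \<in> carrier (free_algebra n)"
        and c: "f \<in> carrier (free_algebra n)"
        by (auto simp: coord_kernel_def)
      then show "\<ominus>\<^bsub>free_algebra n\<^esub> f \<in> coord_kernel n"
        using f free_algebra_a_inv[OF c] by (simp add: coord_kernel_def coord_uminus)
    next
      fix f g assume "f \<in> coord_kernel n" "g \<in> coord_kernel n"
      then show "f \<oplus>\<^bsub>free_algebra n\<^esub> g \<in> coord_kernel n"
        using add.m_closed[of f g]
        by (simp add: coord_kernel_def free_algebra_ops distrib_left distrib_right coord_add)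
    qed (auto simp: coord_kernel_def)
  next
    fix f x assume "f \<in> coord_kernel n" "x \<in> carrier (free_algebra n)"
    then show "x \<otimes>\<^bsub>free_algebra n\<^esub> f \<in> coord_kernel n"
      using m_closed[of x f] by (simp add: coord_kernel_def free_algebra_ops mult.assoc[symmetric])
  next
    fix f x assume *: "f \<in> coord_kernel n" "x \<in> carrier (free_algebra n)"
    then have "coord y (g * (f * x) * h) = 0" for y g h
      using * by (auto simp: coord_kernel_def mult.assoc)
    then show "f \<otimes>\<^bsub>free_algebra n\<^esub> x \<in> coord_kernel n"
      using * m_closed[of f x] by (simp add: coord_kernel_def free_algebra_ops)
  qed (rule ring_free_algebra)
qed

text \<open>Between monomials \<open>u\<close> and \<open>v\<close>, the two terms of a relator
  become words with the same normal form and opposite signs, so their coordinates cancel.\<close>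

lemma clifford_relators_subset_coord_kernel: "clifford_relators n \<subseteq> coord_kernel n"
proof
  fix f assume f: "f \<in> clifford_relators n"
  have "coord x (Poly_Mapping.single u \<alpha> * f * Poly_Mapping.single v \<beta>) = 0" for x u v \<alpha> \<beta>
    using f unfolding clifford_relators_def
  proof (elim UnE CollectE exE conjE)
    fix p q assume "f = letter p * letter q + letter q * letter p" "p \<noteq> q"
    then show ?thesis
      using nform_swap[of "letters u" p q "letters v"] nsign_swap[of p q "letters u" "letters v"]
      by (simp add: letter_def mult_single distrib_left distrib_right coord_add coord_single
          plus_word_def)
  next
    fix p assume "f = letter p * letter p + 1"
    then show ?thesis
      by (simp add: letter_def mult_single distrib_left distrib_right coord_add coord_single
          plus_word_def nform_square nsign_square)
  qed
  then have "coord x (g * f * h) = 0" for x g h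
    by (rule coord_mult_eq_0)
  then show "f \<in> coord_kernel n"
    using f clifford_relators_in_carrier[of n] by (auto simp: coord_kernel_def)
qed

text \<open>\<open>clifford_ideal n\<close> is the least ideal containing the relators, hence lies
  in \<open>coord_kernel n\<close>; the outer factors are then taken to be 1.\<close>

lemma coord_clifford_ideal:
  assumes "f \<in> clifford_ideal n"
  shows "coord x f = 0"
proof -
  have "f \<in> coord_kernel n"
    using assms ring.genideal_minimal[OF ring_free_algebra ideal_coord_kernel
      clifford_relators_subset_coord_kernel] by (auto simp: clifford_ideal_def)
  then have "coord x (1 * f * 1) = 0"
    unfolding coord_kernel_def by blast
  then show ?thesis by simp
qed

section \<open>The quotient map\<close>

definition clifford_class :: "nat \<Rightarrow> ncpoly \<Rightarrow> ncpoly set" where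
  "clifford_class n f = clifford_ideal n +>\<^bsub>free_algebra n\<^esub> f"

lemma clifford_gen_eq: "clifford_gen n p = clifford_class n (letter p)"
  by (simp add: clifford_gen_def clifford_class_def)

lemma clifford_scalar_eq: "clifford_scalar n c = clifford_class n (Poly_Mapping.single 0 c)"
  by (simp add: clifford_scalar_def clifford_class_def)

section \<open>Closure properties of the carrier and of the ideal\<close>

lemma single_in_carrier:
  "set (letters w) \<subseteq> {1..n} \<Longrightarrow> Poly_Mapping.single w c \<in> carrier (free_algebra n)"
  by (simp add: free_algebra_def)

lemma scalar_in_carrier: "Poly_Mapping.single 0 c \<in> carrier (free_algebra n)"
  by (rule single_in_carrier) (simp add: zero_word_def)

lemma add_in_carrier:
  "f \<in> carrier (free_algebra n) \<Longrightarrow> g \<in> carrier (free_algebra n) \<Longrightarrow>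
     f + g \<in> carrier (free_algebra n)"
  using ring.ring_simprules(1)[OF ring_free_algebra, of f n g] by (simp add: free_algebra_ops)

lemma mult_in_carrier:
  "f \<in> carrier (free_algebra n) \<Longrightarrow> g \<in> carrier (free_algebra n) \<Longrightarrow>
     f * g \<in> carrier (free_algebra n)"
  using ring.ring_simprules(5)[OF ring_free_algebra, of f n g] by (simp add: free_algebra_ops)

lemma zero_in_carrier: "0 \<in> carrier (free_algebra n)"
  by (simp add: free_algebra_def)

lemma one_in_carrier: "1 \<in> carrier (free_algebra n)"
  using scalar_in_carrier[of 1 n] by simp

lemma uminus_in_carrier:
  "f \<in> carrier (free_algebra n) \<Longrightarrow> - f \<in> carrier (free_algebra n)"
  by (simp add: free_algebra_def)

lemma sum_in_carrier:
  "(\<And>x. x \<in> A \<Longrightarrow> f x \<in> carrier (free_algebra n)) \<Longrightarrow> sum f A \<in> carrier (free_algebra n)"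
  by (induction A rule: infinite_finite_induct) (simp_all add: add_in_carrier zero_in_carrier)

lemmas in_carrier = single_in_carrier scalar_in_carrier add_in_carrier mult_in_carrier
  zero_in_carrier one_in_carrier uminus_in_carrier sum_in_carrier

lemma clifford_ideal_add:
  "f \<in> clifford_ideal n \<Longrightarrow> g \<in> clifford_ideal n \<Longrightarrow> f + g \<in> clifford_ideal n"
  using additive_subgroup.a_closed[OF ideal.axioms(1)[OF ideal_clifford_ideal], of f n g]
  by (simp add: free_algebra_ops)

lemma clifford_ideal_zero: "0 \<in> clifford_ideal n"
  using additive_subgroup.zero_closed[OF ideal.axioms(1)[OF ideal_clifford_ideal], of n]
  by (simp add: free_algebra_ops)

lemma clifford_ideal_mult_left:
  "f \<in> clifford_ideal n \<Longrightarrow> g \<in> carrier (free_algebra n) \<Longrightarrow> g * f \<in> clifford_ideal n"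
  using ideal.I_l_closed[OF ideal_clifford_ideal, of f n g] by (simp add: free_algebra_ops)

lemma clifford_ideal_mult_right:
  "f \<in> clifford_ideal n \<Longrightarrow> g \<in> carrier (free_algebra n) \<Longrightarrow> f * g \<in> clifford_ideal n"
  using ideal.I_r_closed[OF ideal_clifford_ideal, of f n g] by (simp add: free_algebra_ops)

lemma clifford_ideal_diff:
  assumes "f \<in> clifford_ideal n" "g \<in> clifford_ideal n"
  shows "f - g \<in> clifford_ideal n"
proof -
  have "(- 1) * g \<in> clifford_ideal n"
    by (intro clifford_ideal_mult_left assms in_carrier)
  from clifford_ideal_add[OF assms(1) this] show ?thesis by simp
qed

lemma clifford_ideal_sum:
  "(\<And>x. x \<in> A \<Longrightarrow> f x \<in> clifford_ideal n) \<Longrightarrow> sum f A \<in> clifford_ideal n"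
  by (induction A rule: infinite_finite_induct)
    (simp_all add: clifford_ideal_add clifford_ideal_zero)

lemma clifford_relators_subset_ideal: "clifford_relators n \<subseteq> clifford_ideal n"
  unfolding clifford_ideal_def
  by (rule ring.genideal_self[OF ring_free_algebra clifford_relators_in_carrier])

section \<open>Congruence of each word to its signed normal form\<close>

lemma letter_mult_single:
  "letter p * Poly_Mapping.single (Word w) c = Poly_Mapping.single (Word (p # w)) c"
  by (simp add: letter_def mult_single plus_word_def)

lemma single_toggle_congruent:
  assumes "p \<in> {1..n}" "set w \<subseteq> {1..n}"
  shows "letter p * Poly_Mapping.single (Word w) c
    - Poly_Mapping.single (Word (toggle p w)) (toggle_sign p w * c) \<in> clifford_ideal n"
  using assms(2)
proof (induction w)
  case Nil
  then show ?case by (simp add: letter_mult_single clifford_ideal_zero)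
next
  case (Cons q w)
  let ?s = "Poly_Mapping.single (Word w) c"
  have s: "?s \<in> carrier (free_algebra n)" and q: "letter q \<in> carrier (free_algebra n)"
    using Cons.prems by (auto intro!: single_in_carrier letter_in_carrier)
  consider "p < q" | "p = q" | "q < p" by linarith
  then show ?case
  proof cases
    case 1
    then show ?thesis by (simp add: letter_mult_single clifford_ideal_zero)
  next
    case 2
    have "letter p * letter p + 1 \<in> clifford_ideal n"
      using assms(1) by (intro subsetD[OF clifford_relators_subset_ideal])
        (auto simp: clifford_relators_def)
    from clifford_ideal_mult_right[OF this s] 2 show ?thesis
      by (simp add: letter_mult_single distrib_right mult.assoc single_uminus)
  next
    case 3
    \<comment> \<open>The anticommutator times the tail moves \<open>p\<close> past \<open>q\<close>
      with one sign change; subtracting \<open>letter q\<close> times the induction hypothesis then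
      sorts \<open>p\<close> into the tail.\<close>
    have "letter p * letter q + letter q * letter p \<in> clifford_ideal n"
      using assms(1) 3 Cons.prems by (intro subsetD[OF clifford_relators_subset_ideal])
        (fastforce simp: clifford_relators_def)
    from clifford_ideal_diff[OF clifford_ideal_mult_right[OF this s]
        clifford_ideal_mult_left[OF Cons.IH q]] 3 Cons.prems
    show ?thesis
      by (simp add: letter_mult_single distrib_right right_diff_distrib mult.assoc single_uminus)
  qed
qed

lemma single_nform_congruent:
  assumes "set w \<subseteq> {1..n}"
  shows "Poly_Mapping.single (Word w) c
    - Poly_Mapping.single (Word (nform w)) (nsign w * c) \<in> clifford_ideal n"
  using assms
proof (induction w)
  case Nil
  then show ?case by (simp add: clifford_ideal_zero)
next
  case (Cons p w)
  then have p: "letter p \<in> carrier (free_algebra n)"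
    by (auto intro: letter_in_carrier)
  have "letter p * Poly_Mapping.single (Word (nform w)) (nsign w * c)
    - Poly_Mapping.single (Word (toggle p (nform w))) (toggle_sign p (nform w) * (nsign w * c))
    \<in> clifford_ideal n"
    using Cons.prems set_nform[of w] by (intro single_toggle_congruent) auto
  from clifford_ideal_add[OF clifford_ideal_mult_left[OF Cons.IH p] this] Cons.prems
  show ?case by (simp add: letter_mult_single right_diff_distrib mult.assoc)
qed

section \<open>The quotient map as a ring homomorphism\<close>

lemma clifford_class_hom: "clifford_class n \<in> ring_hom (free_algebra n) (clifford n)"
  unfolding clifford_class_def[abs_def] clifford_def
  by (rule ideal.rcos_ring_hom[OF ideal_clifford_ideal])

lemma ring_hom_ring_clifford_class:
  "ring_hom_ring (free_algebra n) (clifford n) (clifford_class n)"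
  by (rule ring_hom_ringI2[OF ring_free_algebra ring_clifford clifford_class_hom])

lemma clifford_class_closed:
  "f \<in> carrier (free_algebra n) \<Longrightarrow> clifford_class n f \<in> carrier (clifford n)"
  by (rule ring_hom_memE(1)[OF clifford_class_hom])

lemma clifford_class_add:
  "f \<in> carrier (free_algebra n) \<Longrightarrow> g \<in> carrier (free_algebra n) \<Longrightarrow>
     clifford_class n f \<oplus>\<^bsub>clifford n\<^esub> clifford_class n g = clifford_class n (f + g)"
  using ring_hom_memE(3)[OF clifford_class_hom, of f n g] by (simp add: free_algebra_ops)

lemma clifford_class_mult:
  "f \<in> carrier (free_algebra n) \<Longrightarrow> g \<in> carrier (free_algebra n) \<Longrightarrow>
     clifford_class n f \<otimes>\<^bsub>clifford n\<^esub> clifford_class n g = clifford_class n (f * g)"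
  using ring_hom_memE(2)[OF clifford_class_hom, of f n g] by (simp add: free_algebra_ops)

lemma clifford_class_one: "\<one>\<^bsub>clifford n\<^esub> = clifford_class n 1"
  using ring_hom_memE(4)[OF clifford_class_hom, of n] by (simp add: free_algebra_ops)

lemma clifford_class_zero: "\<zero>\<^bsub>clifford n\<^esub> = clifford_class n 0"
  using ring_hom_zero[OF clifford_class_hom ring_free_algebra ring_clifford, of n]
  by (simp add: free_algebra_ops)

lemma clifford_class_minus:
  assumes "f \<in> carrier (free_algebra n)" "g \<in> carrier (free_algebra n)"
  shows "clifford_class n f \<ominus>\<^bsub>clifford n\<^esub> clifford_class n g = clifford_class n (f - g)"
proof -
  interpret ring_hom_ring "free_algebra n" "clifford n" "clifford_class n"
    by (rule ring_hom_ring_clifford_class)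
  have "\<ominus>\<^bsub>clifford n\<^esub> clifford_class n g = clifford_class n (- g)"
    using hom_a_inv[OF assms(2)] free_algebra_a_inv[OF assms(2)] by simp
  then show ?thesis
    using assms clifford_class_add[of f n "- g"] by (simp add: a_minus_def in_carrier)
qed

lemma clifford_class_eq_iff:
  assumes "f \<in> carrier (free_algebra n)" "g \<in> carrier (free_algebra n)"
  shows "clifford_class n f = clifford_class n g \<longleftrightarrow> f - g \<in> clifford_ideal n"
  using ring.quotient_eq_iff_same_a_r_cos[OF ring_free_algebra ideal_clifford_ideal assms] assms
  by (simp add: clifford_class_def a_minus_def free_algebra_a_inv free_algebra_ops)

text \<open>Coordinates vanish on the ideal and therefore descend to the quotient, where they
  separate classes.\<close>

lemma clifford_class_coord:
  assumes "clifford_class n f = clifford_class n g"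
    "f \<in> carrier (free_algebra n)" "g \<in> carrier (free_algebra n)"
  shows "coord v f = coord v g"
  using assms coord_clifford_ideal[of "f - g" n v] by (simp add: clifford_class_eq_iff coord_diff)

section \<open>Scalars and linear combinations\<close>

lemma subfield_scalars: "subfield (range (Poly_Mapping.single 0)) (free_algebra n)"
proof -
  interpret ring "free_algebra n" by (rule ring_free_algebra)
  let ?K = "range (Poly_Mapping.single 0) :: ncpoly set"
  have one: "1 = (Poly_Mapping.single 0 1 :: ncpoly)" by simp
  have subring: "subring ?K (free_algebra n)"
    by (rule subringI)
      (auto simp: in_carrier free_algebra_a_inv free_algebra_ops mult_single one
        simp del: single_one simp flip: single_uminus single_add)
  show ?thesis
  proof (rule subfieldI)
    show "subcring ?K (free_algebra n)"
      by (rule subcringI[OF subring]) (auto simp: free_algebra_ops mult_single mult.commute)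
    have "x \<in> Units (free_algebra n\<lparr>carrier := ?K\<rparr>)" if x: "x \<in> ?K" "x \<noteq> 0" for x
    proof -
      obtain c where c: "x = Poly_Mapping.single 0 c" using x by auto
      with x have "c \<noteq> 0" by auto
      then show ?thesis
        by (auto simp: Units_def c free_algebra_ops mult_single intro!: exI[of _ "inverse c"])
    qed
    moreover have "0 \<notin> Units (free_algebra n\<lparr>carrier := ?K\<rparr>)"
      by (simp add: Units_def free_algebra_ops)
    ultimately show "Units (free_algebra n\<lparr>carrier := ?K\<rparr>) = ?K - {\<zero>\<^bsub>free_algebra n\<^esub>}"
      by (auto simp: free_algebra_ops Units_def)
  qed
qed

lemma subfield_clifford_scalars: "subfield (clifford_scalars n) (clifford n)"
proof -
  \<comment> \<open>The image of a subfield is a subfield once the quotient is nontrivial; the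
    coordinate at the empty word tells 1 from 0.\<close>
  have "clifford_class n 1 \<noteq> clifford_class n 0"
    using clifford_class_coord[of n 1 0 "[]"] coord_single[of "[]" 0 1]
    by (auto simp: in_carrier zero_word_def[symmetric]) (simp add: zero_word_def)
  then have "subfield (clifford_class n ` range (Poly_Mapping.single 0)) (clifford n)"
    by (intro ring_hom_ring.img_is_subfield[OF ring_hom_ring_clifford_class subfield_scalars])
      (simp add: clifford_class_one clifford_class_zero)
  then show ?thesis
    by (simp add: clifford_scalars_def clifford_scalar_eq[abs_def] image_image)
qed

text \<open>Turns a combination of lists in the quotient into the class of one finite sum; indexing
  the coefficients by the entries of \<open>vs\<close> instead of positions relies on
  \<open>distinct vs\<close>.\<close>

lemma combine_clifford_class:
  assumes "\<And>v. v \<in> set vs \<Longrightarrow> f v \<in> carrier (free_algebra n)" "distinct vs"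
  shows "ring.combine (clifford n) (map (\<lambda>v. clifford_scalar n (c v)) vs)
      (map (\<lambda>v. clifford_class n (f v)) vs)
    = clifford_class n (\<Sum>v\<in>set vs. Poly_Mapping.single 0 (c v) * f v)"
proof -
  interpret ring "clifford n" by (rule ring_clifford)
  show ?thesis
    using assms
    by (induction vs)
      (simp_all add: clifford_class_zero clifford_class_mult clifford_class_add in_carrier
        clifford_scalar_eq)
qed

section \<open>The subalgebra generated by the first three generators\<close>

definition basis3 :: "nat list set" where
  "basis3 = {[], [1], [2], [3], [1, 2], [1, 3], [2, 3], [1, 2, 3]}"

definition vec3 :: "(nat list \<Rightarrow> complex) \<Rightarrow> ncpoly" where
  "vec3 c = (\<Sum>v\<in>basis3. Poly_Mapping.single (Word v) (c v))"

definition mul3 :: "(nat list \<Rightarrow> complex) \<Rightarrow> (nat list \<Rightarrow> complex) \<Rightarrow> nat list \<Rightarrow> complex" where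
  "mul3 c d v = (\<Sum>u\<in>basis3. \<Sum>w\<in>basis3.
     if nform (u @ w) = v then nsign (u @ w) * (c u * d w) else 0)"

lemma finite_basis3: "finite basis3"
  by (simp add: basis3_def)

lemma basis3_letters: "n \<ge> 3 \<Longrightarrow> v \<in> basis3 \<Longrightarrow> set v \<subseteq> {1..n}"
  by (auto simp: basis3_def)

lemma nform_basis3: "v \<in> basis3 \<Longrightarrow> nform v = v"
  by (auto simp: basis3_def)

lemma nsign_basis3: "v \<in> basis3 \<Longrightarrow> nsign v = 1"
  by (auto simp: basis3_def)

lemma nform_append_basis3: "u \<in> basis3 \<Longrightarrow> v \<in> basis3 \<Longrightarrow> nform (u @ v) \<in> basis3"
  by (auto simp: basis3_def)

lemma vec3_in_carrier: "n \<ge> 3 \<Longrightarrow> vec3 c \<in> carrier (free_algebra n)"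
  unfolding vec3_def by (intro in_carrier) (use basis3_letters in auto)

lemma coord_vec3: "v \<in> basis3 \<Longrightarrow> coord v (vec3 c) = c v"
  by (simp add: vec3_def coord_sum coord_single nform_basis3 nsign_basis3 finite_basis3
      cong: sum.cong)

lemma single_sum:
  "Poly_Mapping.single w (sum f A) = (\<Sum>x\<in>A. Poly_Mapping.single w (f x))"
  by (induction A rule: infinite_finite_induct) (simp_all add: single_add)

text \<open>Expanding the product gives the words \<open>u @ w\<close>, and expanding
  \<open>mul3\<close> gives their signed normal forms, so the difference is a sum of congruences of
  single words.\<close>

lemma vec3_mult_congruent:
  assumes "n \<ge> 3"
  shows "vec3 c * vec3 d - vec3 (mul3 c d) \<in> clifford_ideal n"
proof -
  have "vec3 (mul3 c d) = (\<Sum>v\<in>basis3. \<Sum>u\<in>basis3. \<Sum>w\<in>basis3. if nform (u @ w) = v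
      then Poly_Mapping.single (Word v) (nsign (u @ w) * (c u * d w)) else 0)"
    unfolding vec3_def mul3_def
    by (simp add: finite_basis3 single_sum if_distrib cong: if_cong)
  also have "\<dots> = (\<Sum>u\<in>basis3. \<Sum>w\<in>basis3. \<Sum>v\<in>basis3. if nform (u @ w) = v
      then Poly_Mapping.single (Word v) (nsign (u @ w) * (c u * d w)) else 0)"
    by (subst sum.swap) (intro sum.cong refl sum.swap)
  \<comment> \<open>The inner sum has exactly one matching \<open>v\<close>, since
    \<open>nform (u @ w)\<close> lies in \<open>basis3\<close> again.\<close>
  also have "\<dots> = (\<Sum>u\<in>basis3. \<Sum>w\<in>basis3.
      Poly_Mapping.single (Word (nform (u @ w))) (nsign (u @ w) * (c u * d w)))"
    by (intro sum.cong refl) (simp add: finite_basis3 nform_append_basis3)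
  finally have "vec3 c * vec3 d - vec3 (mul3 c d) = (\<Sum>u\<in>basis3. \<Sum>w\<in>basis3.
      Poly_Mapping.single (Word (u @ w)) (c u * d w)
      - Poly_Mapping.single (Word (nform (u @ w))) (nsign (u @ w) * (c u * d w)))"
    by (simp add: vec3_def sum_product mult_single plus_word_def sum_subtractf)
  also have "\<dots> \<in> clifford_ideal n"
    using assms
    by (intro clifford_ideal_sum single_nform_congruent) (use basis3_letters in fastforce)
  finally show ?thesis .
qed

lemma clifford_class_vec3_mult:
  assumes "n \<ge> 3"
  shows "clifford_class n (vec3 c) \<otimes>\<^bsub>clifford n\<^esub> clifford_class n (vec3 d)
    = clifford_class n (vec3 (mul3 c d))"
  using assms by (simp add: clifford_class_mult vec3_in_carrier clifford_class_eq_iff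
      mult_in_carrier vec3_mult_congruent)

lemma map_scalars:
  assumes "set Ks \<subseteq> clifford_scalars n" "length Ks = length vs" "distinct vs"
  obtains c where "Ks = map (\<lambda>v. clifford_scalar n (c v)) vs"
proof -
  have "\<forall>x\<in>set Ks. \<exists>c. x = clifford_scalar n c"
    using assms(1) by (auto simp: clifford_scalars_def)
  then obtain g where "\<And>x. x \<in> set Ks \<Longrightarrow> clifford_scalar n (g x) = x"
    by metis
  then have "Ks = map (\<lambda>v. clifford_scalar n (g (the (map_of (zip vs Ks) v)))) vs"
    using assms(2,3) by (intro nth_equalityI) (simp_all add: map_of_zip_nth)
  then show thesis by (rule that)
qed

section \<open>Hyperplanes given as graphs\<close>

text \<open>The point of the graph above the basis vector \<open>v\<close>, with \<open>T\<close>
  the distinguished word. If \<open>t v = 0\<close> it is \<open>v\<close> itself, which covers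
  generators such as \<open>1\<close> and \<open>z\<close>.\<close>

definition graph_basis :: "nat \<Rightarrow> (nat list \<Rightarrow> complex) \<Rightarrow> nat list \<Rightarrow> nat list \<Rightarrow> ncpoly set" where
  "graph_basis n t T v =
     clifford_class n (Poly_Mapping.single (Word v) 1 + Poly_Mapping.single (Word T) (t v))"

locale hyperplane =
  fixes n :: nat and t :: "nat list \<Rightarrow> complex" and T :: "nat list" and vs :: "nat list list"
  assumes n: "n \<ge> 3" and distinct: "distinct vs" and set_vs: "set vs = basis3 - {T}"
    and T: "T \<in> basis3"
begin

interpretation ring "clifford n" by (rule ring_clifford)

definition on_hyperplane :: "(nat list \<Rightarrow> complex) \<Rightarrow> bool" where
  "on_hyperplane c \<longleftrightarrow> c T = (\<Sum>v\<in>set vs. t v * c v)"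

lemma basis_single_closed:
  "v \<in> basis3 \<Longrightarrow> Poly_Mapping.single (Word v) c \<in> carrier (free_algebra n)"
  using n by (intro single_in_carrier) (simp only: word.sel basis3_letters)

lemma graph_basis_closed: "set (map (graph_basis n t T) vs) \<subseteq> carrier (clifford n)"
  using set_vs T
  by (auto simp: graph_basis_def intro!: clifford_class_closed add_in_carrier basis_single_closed)

text \<open>Each \<open>c v\<close> enters at the word \<open>v\<close> through one generator only,
  while all generators feed the word \<open>T\<close>; so the coordinates off \<open>T\<close> are
  free and the one at \<open>T\<close> is forced.\<close>

lemma combine_graph_basis:
  "combine (map (\<lambda>v. clifford_scalar n (c v)) vs) (map (graph_basis n t T) vs)
     = clifford_class n (vec3 (c(T := \<Sum>v\<in>set vs. t v * c v)))"
proof -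
  have "combine (map (\<lambda>v. clifford_scalar n (c v)) vs) (map (graph_basis n t T) vs)
    = clifford_class n (\<Sum>v\<in>set vs. Poly_Mapping.single 0 (c v)
        * (Poly_Mapping.single (Word v) 1 + Poly_Mapping.single (Word T) (t v)))"
    unfolding graph_basis_def
    using set_vs T distinct
    by (intro combine_clifford_class) (auto intro!: add_in_carrier basis_single_closed)
  also have "(\<Sum>v\<in>set vs. Poly_Mapping.single 0 (c v)
        * (Poly_Mapping.single (Word v) 1 + Poly_Mapping.single (Word T) (t v)))
    = vec3 (c(T := \<Sum>v\<in>set vs. t v * c v))"
    using T finite_basis3 unfolding vec3_def
    by (simp add: sum.remove[of basis3 T] set_vs distrib_left mult_single single_sum
        sum.distrib mult.commute)
  finally show ?thesis .
qed

lemma Span_eq: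
  "Span (clifford_scalars n) (map (graph_basis n t T) vs)
     = {clifford_class n (vec3 c) |c. on_hyperplane c}"
    (is "?S = ?H")
proof (intro equalityI subsetI)
  fix x assume "x \<in> ?S"
  then obtain Ks where Ks: "set Ks \<subseteq> clifford_scalars n" "length Ks = length vs"
    "x = combine Ks (map (graph_basis n t T) vs)"
    using Span_mem_iff_length_version[OF subfield_clifford_scalars graph_basis_closed]
    by auto
  from map_scalars[OF Ks(1,2) distinct] obtain c
    where "Ks = map (\<lambda>v. clifford_scalar n (c v)) vs" .
  \<comment> \<open>\<open>T\<close> does not occur in \<open>vs\<close>, so the update at
    \<open>T\<close> leaves the sum unchanged.\<close>
  moreover have "on_hyperplane (c(T := \<Sum>v\<in>set vs. t v * c v))"
    by (auto simp: on_hyperplane_def set_vs intro!: sum.cong)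
  ultimately show "x \<in> ?H"
    using Ks(3) combine_graph_basis by auto
next
  fix x assume "x \<in> ?H"
  then obtain c where c: "on_hyperplane c" "x = clifford_class n (vec3 c)"
    by auto
  then have "c(T := \<Sum>v\<in>set vs. t v * c v) = c"
    by (auto simp: on_hyperplane_def)
  then show "x \<in> ?S"
    using c combine_graph_basis[of c]
    by (subst Span_mem_iff_length_version[OF subfield_clifford_scalars graph_basis_closed])
      (auto simp: clifford_scalars_def intro!: exI[of _ "map (\<lambda>v. clifford_scalar n (c v)) vs"])
qed

lemma independent_graph_basis:
  "independent (clifford_scalars n) (map (graph_basis n t T) vs)"
proof (rule trivial_combine_imp_independent[OF subfield_clifford_scalars graph_basis_closed])
  fix Ks assume K: "set Ks \<subseteq> clifford_scalars n"
    and 0: "combine Ks (map (graph_basis n t T) vs) = \<zero>\<^bsub>clifford n\<^esub>"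
  have K': "set Ks \<subseteq> carrier (clifford n)"
    using K subfieldE(3)[OF subfield_clifford_scalars] by blast
  have z: "\<zero>\<^bsub>clifford n\<^esub> = clifford_scalar n 0"
    by (simp add: clifford_scalar_eq clifford_class_zero)
  \<comment> \<open>A relation may come with a coefficient list of any length; it is cut or padded
    with zeros to the length of \<open>vs\<close>.\<close>
  obtain Ks' where Ks': "set (take (length vs) Ks) \<subseteq> set Ks'"
    "set Ks' \<subseteq> set (take (length vs) Ks) \<union> {\<zero>\<^bsub>clifford n\<^esub>}" "length Ks' = length vs"
    "combine Ks' (map (graph_basis n t T) vs) = \<zero>\<^bsub>clifford n\<^esub>"
    using combine_normalize[OF K' graph_basis_closed 0] by auto
  have "set Ks' \<subseteq> clifford_scalars n"
    using Ks'(2) K set_take_subset[of "length vs" Ks] by (auto simp: z clifford_scalars_def)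
  from map_scalars[OF this Ks'(3) distinct] obtain c
    where c: "Ks' = map (\<lambda>v. clifford_scalar n (c v)) vs" .
  let ?c = "c(T := \<Sum>v\<in>set vs. t v * c v)"
  have "clifford_class n (vec3 ?c) = clifford_class n 0"
    using Ks'(4) combine_graph_basis by (simp add: c clifford_class_zero)
  then have "coord v (vec3 ?c) = 0" for v
    using clifford_class_coord[of n "vec3 ?c" 0] n by (simp add: vec3_in_carrier in_carrier)
  then have "c v = 0" if "v \<in> set vs" for v
    using that set_vs coord_vec3[of v ?c] by simp
  then have "set Ks' \<subseteq> {\<zero>\<^bsub>clifford n\<^esub>}"
    by (auto simp: c z)
  then show "set (take (length (map (graph_basis n t T) vs)) Ks) \<subseteq> {\<zero>\<^bsub>clifford n\<^esub>}"
    using Ks'(1) by auto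
qed

lemma dimension_span: "clifford_dimension n 7 (clifford_span n (map (graph_basis n t T) vs))"
proof -
  have "card basis3 = 8" by (simp add: basis3_def)
  then have "length vs = 7"
    using distinct_card[OF distinct] set_vs T finite_basis3 by simp
  then show ?thesis
    using dimension_independent[OF independent_graph_basis]
    by (simp add: clifford_dimension_def clifford_span_def del: Span.simps)
qed

lemma subalgebra_span:
  assumes "\<And>c d. on_hyperplane c \<Longrightarrow> on_hyperplane d \<Longrightarrow> on_hyperplane (mul3 c d)"
  shows "clifford_subalgebra n (clifford_span n (map (graph_basis n t T) vs))"
  using Span_is_subalgebra[OF subfield_clifford_scalars graph_basis_closed] assms n
  unfolding clifford_subalgebra_def clifford_span_def Span_eq
  by (auto simp: clifford_class_vec3_mult)

end

section \<open>The two families\<close>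

text \<open>The 64 products of basis words are normalized by evaluation. The symmetry of the terms
  with \<open>[1, 2, 3]\<close> reflects that \<open>z\<close> is central, and the last sign in the
  first row that \<open>z\<close> squares to 1.\<close>

lemma mul3_table:
  "mul3 c d [] =
     c [] * d [] - c [1] * d [1] - c [2] * d [2] - c [3] * d [3] - c [1, 2] * d [1, 2]
     - c [1, 3] * d [1, 3] - c [2, 3] * d [2, 3] + c [1, 2, 3] * d [1, 2, 3]"
  "mul3 c d [1] =
     c [] * d [1] + c [1] * d [] + c [2] * d [1, 2] + c [3] * d [1, 3]
     - c [1, 2] * d [2] - c [1, 3] * d [3] - c [2, 3] * d [1, 2, 3]
     - c [1, 2, 3] * d [2, 3]"
  "mul3 c d [2] =
     c [] * d [2] - c [1] * d [1, 2] + c [2] * d [] + c [3] * d [2, 3]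
     + c [1, 2] * d [1] + c [1, 3] * d [1, 2, 3] - c [2, 3] * d [3]
     + c [1, 2, 3] * d [1, 3]"
  "mul3 c d [3] =
     c [] * d [3] - c [1] * d [1, 3] - c [2] * d [2, 3] + c [3] * d []
     - c [1, 2] * d [1, 2, 3] + c [1, 3] * d [1] + c [2, 3] * d [2]
     - c [1, 2, 3] * d [1, 2]"
  "mul3 c d [1, 2] =
     c [] * d [1, 2] + c [1] * d [2] - c [2] * d [1] - c [3] * d [1, 2, 3]
     + c [1, 2] * d [] + c [1, 3] * d [2, 3] - c [2, 3] * d [1, 3] - c [1, 2, 3] * d [3]"
  "mul3 c d [1, 3] =
     c [] * d [1, 3] + c [1] * d [3] + c [2] * d [1, 2, 3] - c [3] * d [1]
     - c [1, 2] * d [2, 3] + c [1, 3] * d [] + c [2, 3] * d [1, 2] + c [1, 2, 3] * d [2]"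
  "mul3 c d [2, 3] =
     c [] * d [2, 3] - c [1] * d [1, 2, 3] + c [2] * d [3] - c [3] * d [2]
     + c [1, 2] * d [1, 3] - c [1, 3] * d [1, 2] + c [2, 3] * d [] - c [1, 2, 3] * d [1]"
  "mul3 c d [1, 2, 3] =
     c [] * d [1, 2, 3] + c [1] * d [2, 3] - c [2] * d [1, 3] + c [3] * d [1, 2]
     + c [1, 2] * d [3] - c [1, 3] * d [2] + c [2, 3] * d [1] + c [1, 2, 3] * d []"
  by (simp_all add: mul3_def basis3_def)

text \<open>
  For \<open>h\<^sub>1, \<dots>, h\<^sub>4\<close>, \<open>\<epsilon>\<close> is the sign of \<open>k\<close> in the second generator and \<open>s\<close> is one of the two square
  roots of \<open>- 1 - a\<^sup>2\<close>. For \<open>h\<^sub>5, \<dots>, h\<^sub>8\<close>, \<open>\<epsilon>\<close> is the sign of \<open>j\<close> in the third generator and \<open>r\<close> is one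
  of the two square roots of \<open>- 1\<close>.
\<close>

definition h14_slope :: "complex \<Rightarrow> complex \<Rightarrow> complex \<Rightarrow> nat list \<Rightarrow> complex" where
  "h14_slope \<epsilon> s a = (\<lambda>_. 0)([1] := \<epsilon>, [2] := a, [3] := s, [1, 2] := - \<epsilon> * s, [1, 3] := \<epsilon> * a)"

definition h58_slope :: "complex \<Rightarrow> complex \<Rightarrow> nat list \<Rightarrow> complex" where
  "h58_slope \<epsilon> r = (\<lambda>_. 0)([2] := \<epsilon>, [3] := r, [1, 2] := \<epsilon> * r)"

lemma hyperplane_h14:
  "n \<ge> 3 \<Longrightarrow> hyperplane n [2, 3] [[], [1], [2], [3], [1, 2], [1, 3], [1, 2, 3]]"
  by unfold_locales (auto simp: basis3_def)

lemma hyperplane_h58: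
  "n \<ge> 3 \<Longrightarrow> hyperplane n [1, 3] [[], [1], [2], [3], [1, 2], [2, 3], [1, 2, 3]]"
  by unfold_locales (auto simp: basis3_def)

text \<open>The hyperplane says that \<open>x = (c [1] - \<epsilon> * c [2, 3], c [2] + \<epsilon> *
  c [1, 3], c [3] - \<epsilon> * c [1, 2])\<close>, the vector part after setting
  \<open>z = \<epsilon>\<close>, is orthogonal to \<open>(\<epsilon>, a, s)\<close>, which is
  isotropic by the assumptions on the squares. A product of two vectors is a scalar plus a multiple
  of their cross product, and if both are orthogonal to this isotropic vector, their cross product
  is a multiple of it, hence orthogonal to it again.\<close>

lemma h14_closed:
  assumes "\<epsilon> * \<epsilon> = 1" "s * s = - 1 - a * a"
    and c: "c [2, 3] = \<epsilon> * c [1] + a * c [2] + s * c [3] - \<epsilon> * s * c [1, 2] + \<epsilon> * a * c [1, 3]"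
    and d: "d [2, 3] = \<epsilon> * d [1] + a * d [2] + s * d [3] - \<epsilon> * s * d [1, 2] + \<epsilon> * a * d [1, 3]"
  shows "mul3 c d [2, 3] = \<epsilon> * mul3 c d [1] + a * mul3 c d [2] + s * mul3 c d [3]
    - \<epsilon> * s * mul3 c d [1, 2] + \<epsilon> * a * mul3 c d [1, 3]"
proof -
  \<comment> \<open>Expanded monomials are nested to the right, so the rules for the squares are
    also stated with a further factor \<open>x\<close>.\<close>
  have \<epsilon>: "\<epsilon> * (\<epsilon> * x) = x" for x using assms(1) by (simp flip: mult.assoc)
  have s: "s * (s * x) = - x - a * (a * x)" for x
    using arg_cong[OF assms(2), of "\<lambda>y. y * x"] by (simp add: algebra_simps)
  show ?thesis
    unfolding mul3_table c d
    by (simp add: algebra_simps assms(1,2) \<epsilon> s)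
qed

text \<open>The same argument with \<open>z = - \<epsilon>\<close> and the isotropic vector
  \<open>(0, \<epsilon>, r)\<close>.\<close>

lemma h58_closed:
  assumes "\<epsilon> * \<epsilon> = 1" "r * r = - 1"
    and c: "c [1, 3] = \<epsilon> * c [2] + r * c [3] + \<epsilon> * r * c [1, 2]"
    and d: "d [1, 3] = \<epsilon> * d [2] + r * d [3] + \<epsilon> * r * d [1, 2]"
  shows "mul3 c d [1, 3] = \<epsilon> * mul3 c d [2] + r * mul3 c d [3] + \<epsilon> * r * mul3 c d [1, 2]"
proof -
  have \<epsilon>: "\<epsilon> * (\<epsilon> * x) = x" for x using assms(1) by (simp flip: mult.assoc)
  have r: "r * (r * x) = - x" for x
    using assms(2) by (simp flip: mult.assoc)
  show ?thesis
    unfolding mul3_table c d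
    by (simp add: algebra_simps assms(1,2) \<epsilon> r)
qed

lemma h14_span:
  assumes "n \<ge> 3" "\<epsilon> * \<epsilon> = 1" "s * s = - 1 - a * a"
    and h: "h = clifford_span n (map (graph_basis n (h14_slope \<epsilon> s a) [2, 3])
      [[], [1], [2], [3], [1, 2], [1, 3], [1, 2, 3]])"
  shows "clifford_subalgebra n h \<and> clifford_dimension n 7 h"
proof -
  interpret hyperplane n "h14_slope \<epsilon> s a" "[2, 3]"
    "[[], [1], [2], [3], [1, 2], [1, 3], [1, 2, 3]]"
    by (rule hyperplane_h14[OF assms(1)])
  have "on_hyperplane c \<longleftrightarrow> c [2, 3] = \<epsilon> * c [1] + a * c [2] + s * c [3]
    - \<epsilon> * s * c [1, 2] + \<epsilon> * a * c [1, 3]" for c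
    unfolding on_hyperplane_def by (simp add: h14_slope_def algebra_simps)
  then show ?thesis
    unfolding h using h14_closed[OF assms(2,3)]
    by (intro conjI subalgebra_span dimension_span) blast
qed

lemma h58_span:
  assumes "n \<ge> 3" "\<epsilon> * \<epsilon> = 1" "r * r = - 1"
    and h: "h = clifford_span n (map (graph_basis n (h58_slope \<epsilon> r) [1, 3])
      [[], [1], [2], [3], [1, 2], [2, 3], [1, 2, 3]])"
  shows "clifford_subalgebra n h \<and> clifford_dimension n 7 h"
proof -
  interpret hyperplane n "h58_slope \<epsilon> r" "[1, 3]"
    "[[], [1], [2], [3], [1, 2], [2, 3], [1, 2, 3]]"
    by (rule hyperplane_h58[OF assms(1)])
  have "on_hyperplane c \<longleftrightarrow> c [1, 3] = \<epsilon> * c [2] + r * c [3] + \<epsilon> * r * c [1, 2]" for c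
    unfolding on_hyperplane_def by (simp add: h58_slope_def algebra_simps)
  then show ?thesis
    unfolding h using h58_closed[OF assms(2,3)]
    by (intro conjI subalgebra_span dimension_span) blast
qed

theorem mainTheorem2:
  fixes n :: nat and sqroot :: "complex \<Rightarrow> complex" and a :: complex
    and G (structure) and e :: "nat \<Rightarrow> ncpoly set" and \<iota> :: "complex \<Rightarrow> ncpoly set"
    and i j k z :: "ncpoly set" and s r :: "ncpoly set"
    and h1 h2 h3 h4 h5 h6 h7 h8 :: "ncpoly set set"
  assumes "n \<ge> 3"
    and "\<forall>w. (sqroot w)\<^sup>2 = w"
    and "G = clifford n" and "e = clifford_gen n" and "\<iota> = clifford_scalar n"
    and "i = e 1 \<otimes> e 2" and "j = e 1 \<otimes> e 3" and "k = e 2 \<otimes> e 3" and "z = e 1 \<otimes> e 2 \<otimes> e 3"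
    and "s = \<iota> (sqroot (- 1 - a\<^sup>2))" and "r = \<iota> (sqroot (- 1))"
    and "h1 = clifford_span n
      [\<one>, e 1 \<oplus> k, e 2 \<oplus> \<iota> a \<otimes> k, e 3 \<oplus> s \<otimes> k, i \<ominus> s \<otimes> k, j \<oplus> \<iota> a \<otimes> k, z]"
    and "h2 = clifford_span n
      [\<one>, e 1 \<oplus> k, e 2 \<oplus> \<iota> a \<otimes> k, e 3 \<ominus> s \<otimes> k, i \<oplus> s \<otimes> k, j \<oplus> \<iota> a \<otimes> k, z]"
    and "h3 = clifford_span n
      [\<one>, e 1 \<ominus> k, e 2 \<oplus> \<iota> a \<otimes> k, e 3 \<oplus> s \<otimes> k, i \<oplus> s \<otimes> k, j \<ominus> \<iota> a \<otimes> k, z]"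
    and "h4 = clifford_span n
      [\<one>, e 1 \<ominus> k, e 2 \<oplus> \<iota> a \<otimes> k, e 3 \<ominus> s \<otimes> k, i \<ominus> s \<otimes> k, j \<ominus> \<iota> a \<otimes> k, z]"
    and "h5 = clifford_span n
      [\<one>, e 1, e 2 \<oplus> j, e 3 \<oplus> r \<otimes> j, i \<oplus> r \<otimes> j, k, z]"
    and "h6 = clifford_span n
      [\<one>, e 1, e 2 \<oplus> j, e 3 \<ominus> r \<otimes> j, i \<ominus> r \<otimes> j, k, z]"
    and "h7 = clifford_span n
      [\<one>, e 1, e 2 \<ominus> j, e 3 \<oplus> r \<otimes> j, i \<ominus> r \<otimes> j, k, z]"
    and "h8 = clifford_span n
      [\<one>, e 1, e 2 \<ominus> j, e 3 \<ominus> r \<otimes> j, i \<oplus> r \<otimes> j, k, z]"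
  shows "\<forall>h \<in> {h1, h2, h3, h4, h5, h6, h7, h8}.
           clifford_subalgebra n h \<and> clifford_dimension n 7 h"
proof -
  define \<sigma> where "\<sigma> = sqroot (- 1 - a\<^sup>2)"
  define \<rho> where "\<rho> = sqroot (- 1)"
  \<comment> \<open>The opposite roots serve \<open>h2\<close>, \<open>h4\<close>, \<open>h6\<close>
    and \<open>h8\<close>.\<close>
  have \<sigma>: "\<sigma> * \<sigma> = - 1 - a * a" "(- \<sigma>) * (- \<sigma>) = - 1 - a * a"
    and \<rho>: "\<rho> * \<rho> = - 1" "(- \<rho>) * (- \<rho>) = - 1"
    using assms(2) by (simp_all add: \<sigma>_def \<rho>_def flip: power2_eq_square)
  have carrier: "Poly_Mapping.single (Word v) c \<in> carrier (free_algebra n)"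
    if "set v \<subseteq> {1, 2, 3}" for v c
    using that assms(1) by (intro single_in_carrier) auto
  have gens: "\<one>\<^bsub>clifford n\<^esub> = clifford_class n (Poly_Mapping.single (Word []) 1)"
    "e p = clifford_class n (Poly_Mapping.single (Word [p]) 1)"
    "\<iota> c = clifford_class n (Poly_Mapping.single (Word []) c)" for p c
    by (simp_all add: assms(3-5) clifford_class_one clifford_gen_eq clifford_scalar_eq letter_def
        flip: zero_word_def)
  \<comment> \<open>Each listed generator becomes the class of an explicit polynomial, and the spans
    then agree generator by generator with those of \<open>graph_basis\<close>.\<close>
  note expand = assms(3,6-11) gens \<sigma>_def[symmetric] \<rho>_def[symmetric] carrier in_carrier
    clifford_class_add clifford_class_mult clifford_class_minus mult_single plus_word_def
    graph_basis_def h14_slope_def h58_slope_def single_uminus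
  have "h1 = clifford_span n (map (graph_basis n (h14_slope 1 \<sigma> a) [2, 3])
      [[], [1], [2], [3], [1, 2], [1, 3], [1, 2, 3]])"
    unfolding assms(12) by (simp add: expand)
  moreover have "h2 = clifford_span n (map (graph_basis n (h14_slope 1 (- \<sigma>) a) [2, 3])
      [[], [1], [2], [3], [1, 2], [1, 3], [1, 2, 3]])"
    unfolding assms(13) by (simp add: expand)
  moreover have "h3 = clifford_span n (map (graph_basis n (h14_slope (- 1) \<sigma> a) [2, 3])
      [[], [1], [2], [3], [1, 2], [1, 3], [1, 2, 3]])"
    unfolding assms(14) by (simp add: expand)
  moreover have "h4 = clifford_span n (map (graph_basis n (h14_slope (- 1) (- \<sigma>) a) [2, 3])
      [[], [1], [2], [3], [1, 2], [1, 3], [1, 2, 3]])"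
    unfolding assms(15) by (simp add: expand)
  moreover have "h5 = clifford_span n (map (graph_basis n (h58_slope 1 \<rho>) [1, 3])
      [[], [1], [2], [3], [1, 2], [2, 3], [1, 2, 3]])"
    unfolding assms(16) by (simp add: expand)
  moreover have "h6 = clifford_span n (map (graph_basis n (h58_slope 1 (- \<rho>)) [1, 3])
      [[], [1], [2], [3], [1, 2], [2, 3], [1, 2, 3]])"
    unfolding assms(17) by (simp add: expand)
  moreover have "h7 = clifford_span n (map (graph_basis n (h58_slope (- 1) \<rho>) [1, 3])
      [[], [1], [2], [3], [1, 2], [2, 3], [1, 2, 3]])"
    unfolding assms(18) by (simp add: expand)
  moreover have "h8 = clifford_span n (map (graph_basis n (h58_slope (- 1) (- \<rho>)) [1, 3])
      [[], [1], [2], [3], [1, 2], [2, 3], [1, 2, 3]])"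
    unfolding assms(19) by (simp add: expand)
  ultimately show ?thesis
    using h14_span[OF assms(1) _ \<sigma>(1), of 1] h14_span[OF assms(1) _ \<sigma>(2), of 1]
      h14_span[OF assms(1) _ \<sigma>(1), of "- 1"] h14_span[OF assms(1) _ \<sigma>(2), of "- 1"]
      h58_span[OF assms(1) _ \<rho>(1), of 1] h58_span[OF assms(1) _ \<rho>(2), of 1]
      h58_span[OF assms(1) _ \<rho>(1), of "- 1"] h58_span[OF assms(1) _ \<rho>(2), of "- 1"]
    by simp
qed

end
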